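(* Let $a,b,c\ge 2$ be pairwise relatively prime integers, and let $g(a,b,c)$ be their Frobenius number, i.e. the largest integer $n$ that cannot be written as $n=m_1a+m_2b+m_3c$ with nonnegative integers $m_1,m_2,m_3$. For pairwise relatively prime integers $x,y\ge1$ and $z\ge 2$ define $L(x,y;z)$ as follows: let $z_1$ be the least nonnegative residue of $-x^{-1}y$ modulo $z$ (where $xx^{-1}\equiv 1\pmod z$), and let $z_2$ be the least nonnegative residue of $z$ modulo $z_1$. Set \[ L(x,y;z)=\begin{cases} -\dfrac{z}{24}+\dfrac{1}{6z}-\dfrac34 & \text{if } z_1=1,\\[2mm] \dfrac{z_1}{12z}+\dfrac{1}{12z_1z}-\dfrac{z}{24z_1}-\dfrac{1}{6z_1}-\dfrac{z_1}{12}-\dfrac34 & \text{if } z_1\ne1,\ z_2=1,\\[2mm] \dfrac{z_1}{12z}+\dfrac{1}{12z_1z}-\dfrac{z}{24z_1}-\dfrac{z_2}{12z_1}-\dfrac{1}{12z_1z_2}-\dfrac{z_1}{12z_2}-\dfrac34-\sqrt{\left(\dfrac{z_2}{12}+\dfrac{1}{6z_2}\right)\left(\dfrac{z_2}{12}-\dfrac14+\dfrac{1}{6z_2}\right)} & \text{if } z_1\ne1,\ z_2\ne1.\end{cases} \] Let $\alpha=L(b,c;a)$, $\beta=L(c,a;b)$, $\gamma=L(a,b;c)$. Then \[ g(a,b,c)\le \sqrt{\tfrac14(a+b+c)^2-\tfrac16(a^2+b^2+c^2)-2abc(\alpha+\beta+\gamma)}\;-\;\tfrac12(a+b+c). \]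
   Context: $L(x,y;z)$ is, for every integer $t$, a lower bound for $\sigma_t(x,y;z)=\sum_{m=0}^{z-1}\left(\!\left(\frac{-x^{-1}(ym+t)}{z}\right)\!\right)\left(\!\left(\frac{m}{z}\right)\!\right)$, where $((u))=u-\lfloor u\rfloor-\frac12$; $\alpha,\beta,\gamma$ are these lower bounds for $\sigma_t(b,c;a)$, $\sigma_t(c,a;b)$, $\sigma_t(a,b;c)$ respectively. *)

theory Defs
  imports Complex_Main "HOL-Number_Theory.Modular_Inverse"
begin

definition representable3 :: "int \<Rightarrow> int \<Rightarrow> int \<Rightarrow> int \<Rightarrow> bool" where
  "representable3 a b c n \<longleftrightarrow>
     (\<exists>m1 m2 m3. m1 \<ge> 0 \<and> m2 \<ge> 0 \<and> m3 \<ge> 0 \<and> n = m1 * a + m2 * b + m3 * c)"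

text \<open>
  The greatest element exists whenever the positive integers a, b, c have no common factor;
  otherwise the value is unspecified.
\<close>
definition frobenius3 :: "int \<Rightarrow> int \<Rightarrow> int \<Rightarrow> int" where
  "frobenius3 a b c = (GREATEST n. \<not> representable3 a b c n)"

text \<open>
  Meaningful for x, y coprime to z and z at least 2: then the residue z1 is at least 1, and if
  it is not 1 then z2 is at least 1, so no denominator vanishes; moreover the radicand in the
  last case is nonnegative for every z2 at least 2.
\<close>
definition L :: "int \<Rightarrow> int \<Rightarrow> int \<Rightarrow> real" where
  "L x y z =
    (let z1 = (- modular_inverse z x * y) mod z;
         z2 = z mod z1;
         r = real_of_int z;
         r1 = real_of_int z1;
         r2 = real_of_int z2
     in if z1 = 1 then
          - r / 24 + 1 / (6 * r) - 3 / 4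
        else if z2 = 1 then
          r1 / (12 * r) + 1 / (12 * r1 * r) - r / (24 * r1) - 1 / (6 * r1) - r1 / 12 - 3 / 4
        else
          r1 / (12 * r) + 1 / (12 * r1 * r) - r / (24 * r1) - r2 / (12 * r1)
            - 1 / (12 * r1 * r2) - r1 / (12 * r2) - 3 / 4
            - sqrt ((r2 / 12 + 1 / (6 * r2)) * (r2 / 12 - 1 / 4 + 1 / (6 * r2))))"

end

theory Submission
  imports Defs
begin

text \<open>
  Reduce the coefficients of a representation n = m1 a + m2 b + m3 c over the integers modulo
  bc, ca, ab: the reduced triples are parametrised by residues x, y, z modulo a, b, c, and the
  quotients add up to an integer J determined by (x, y, z).  For a nonrepresentable n only
  J = -1 and J = -2 occur, so the sum of (J + 1)(J + 2) over all (x, y, z) vanishes.  Expanding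
  it, the cross terms collapse to the three Dedekind sums, and n is a root of
  n^2 + n(a+b+c) + (a^2+b^2+c^2)/6 + 2abc(sum of the Dedekind sums).  A lower bound for the
  Dedekind sums therefore bounds n.  Two steps of reciprocity and a trivial estimate
  of the remaining sum give more than L, whose constant -3/4 is generous.
\<close>

section \<open>Sawtooth function and shifted Dedekind sums\<close>

text \<open>The value at integers is -1/2, not the classical 0. This is the first Bernoulli
  polynomial at the fractional part of p/k, so the distribution relation holds at every
  argument.\<close>

definition saw :: "int \<Rightarrow> int \<Rightarrow> real" where
  "saw p k = real_of_int (p mod k) / real_of_int k - 1 / 2"

text \<open>For h = -x^{-1}y and k = z, shifting by -x^{-1}t gives sigma_t(x,y;z). Since x is a unit
  modulo z, a bound for every shift here is a bound for every t there.\<close>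

definition dedekind_sum :: "int \<Rightarrow> int \<Rightarrow> int \<Rightarrow> real" where
  "dedekind_sum t h k = (\<Sum>m\<in>{0..<k}. saw (h * m + t) k * saw m k)"

lemma saw_mod [simp]: "saw (p mod k) k = saw p k"
  by (simp add: saw_def)

lemma saw_cong: "[p = q] (mod k) \<Longrightarrow> saw p k = saw q k"
  by (simp add: saw_def cong_def)

lemma dedekind_sum_cong:
  assumes "[t = t'] (mod k)" "[h = h'] (mod k)"
  shows "dedekind_sum t h k = dedekind_sum t' h' k"
  unfolding dedekind_sum_def
  by (intro sum.cong refl arg_cong2[where f = "(*)"] saw_cong cong_add cong_mult assms) auto

section \<open>Reindexing over complete residue systems\<close>

lemma sum_affine_mod:
  fixes f :: "int \<Rightarrow> 'a::comm_monoid_add" and h u r :: int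
  assumes "h > 0" "coprime u h"
  shows "(\<Sum>j\<in>{0..<h}. f ((u * j + r) mod h)) = (\<Sum>j\<in>{0..<h}. f j)"
proof -
  let ?g = "\<lambda>j. (u * j + r) mod h"
  have inj: "inj_on ?g {0..<h}"
  proof (rule inj_onI)
    fix i j assume ij: "i \<in> {0..<h}" "j \<in> {0..<h}" and "?g i = ?g j"
    then have "[u * i + r = u * j + r] (mod h)"
      by (simp add: cong_def)
    then have "[i = j] (mod h)"
      using assms by (metis cong_add_rcancel cong_mult_lcancel)
    with ij show "i = j"
      by (simp add: cong_def)
  qed
  have "?g ` {0..<h} = {0..<h}"
    by (rule endo_inj_surj) (use inj assms in auto)
  then show ?thesis
    using sum.reindex[OF inj, of f] by (simp add: o_def)
qed

text \<open>If two arguments agree modulo hk, their difference is divisible by k and by h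
  separately; each divisibility kills one of the two summands and the unit slopes v, u can be
  cancelled. Injectivity and equal cardinality give a bijection.\<close>

lemma sum_crt:
  fixes f :: "int \<Rightarrow> 'a::comm_monoid_add" and h k u v p q r :: int
  assumes "h > 0" "k > 0" "coprime h k" "coprime u h" "coprime v k"
  shows "(\<Sum>m\<in>{0..<k}. \<Sum>j\<in>{0..<h}. f ((p + h * (v * m + q) + k * (u * j + r)) mod (h * k)))
       = (\<Sum>i\<in>{0..<h * k}. f i)"
proof -
  let ?g = "\<lambda>(m, j). (p + h * (v * m + q) + k * (u * j + r)) mod (h * k)"
  have inj: "inj_on ?g ({0..<k} \<times> {0..<h})"
  proof (rule inj_onI, clarify)
    fix m j m' j'
    assume r: "m \<in> {0..<k}" "m' \<in> {0..<k}" "j \<in> {0..<h}" "j' \<in> {0..<h}"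
      and e: "(p + h * (v * m + q) + k * (u * j + r)) mod (h * k)
            = (p + h * (v * m' + q) + k * (u * j' + r)) mod (h * k)"
    have d: "h * k dvd (p + h * (v * m + q) + k * (u * j + r)) - (p + h * (v * m' + q) + k * (u * j' + r))"
      using e by (simp add: mod_eq_dvd_iff)
    have eq: "(p + h * (v * m + q) + k * (u * j + r)) - (p + h * (v * m' + q) + k * (u * j' + r))
       = h * (v * (m - m')) + k * (u * (j - j'))"
      by (simp add: algebra_simps)
    have "k dvd h * (v * (m - m')) + k * (u * (j - j'))" "h dvd h * (v * (m - m')) + k * (u * (j - j'))"
      using d eq by (metis dvd_mult_left dvd_mult_right)+
    then have "k dvd h * (v * (m - m'))" "h dvd k * (u * (j - j'))"
      by (simp_all add: dvd_add_left_iff dvd_add_right_iff)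
    then have "k dvd m - m'" "h dvd j - j'"
      using assms by (metis coprime_commute coprime_dvd_mult_right_iff)+
    with r show "m = m' \<and> j = j'"
      by (simp add: mod_eq_dvd_iff[symmetric])
  qed
  have "?g ` ({0..<k} \<times> {0..<h}) = {0..<h * k}"
  proof (rule card_subset_eq)
    show "?g ` ({0..<k} \<times> {0..<h}) \<subseteq> {0..<h * k}"
      using assms by auto
    show "card (?g ` ({0..<k} \<times> {0..<h})) = card {0..<h * k}"
      using card_image[OF inj] assms by (simp add: nat_mult_distrib mult.commute)
  qed simp
  then show ?thesis
    using sum.reindex[OF inj, of f] by (simp add: o_def sum.cartesian_product case_prod_unfold)
qed

section \<open>Moments of the sawtooth, distribution relation and reciprocity\<close>

lemma sum_int_real:
  assumes "k \<ge> 0"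
  shows "(\<Sum>j\<in>{0..<k}. real_of_int j) = real_of_int k * (real_of_int k - 1) / 2"
  using assms
proof (induction k rule: int_ge_induct)
  case (step i)
  have "{0..<i + 1} = insert i {0..<i}" using step by auto
  then show ?case using step by (simp add: field_simps)
qed simp

lemma sum_int_real_squares:
  assumes "k \<ge> 0"
  shows "(\<Sum>j\<in>{0..<k}. (real_of_int j)\<^sup>2)
    = real_of_int k * (real_of_int k - 1) * (2 * real_of_int k - 1) / 6"
  using assms
proof (induction k rule: int_ge_induct)
  case (step i)
  have "{0..<i + 1} = insert i {0..<i}" using step by auto
  then show ?case using step by (simp add: field_simps power2_eq_square)
qed simp

lemma sum_saw:
  assumes "k > 0"
  shows "(\<Sum>j\<in>{0..<k}. saw j k) = - 1 / 2"
proof -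
  have "(\<Sum>j\<in>{0..<k}. saw j k) = (\<Sum>j\<in>{0..<k}. real_of_int j / real_of_int k - 1 / 2)"
    by (rule sum.cong) (auto simp: saw_def)
  also have "\<dots> = - 1 / 2"
    using assms
    by (simp add: sum_subtractf sum_divide_distrib[symmetric] sum_int_real) (simp add: field_simps)
  finally show ?thesis .
qed

lemma sum_saw_squares:
  assumes "k > 0"
  shows "(\<Sum>j\<in>{0..<k}. (saw j k)\<^sup>2) = real_of_int k / 12 + 1 / (6 * real_of_int k)"
proof -
  have "(\<Sum>j\<in>{0..<k}. (saw j k)\<^sup>2)
      = (\<Sum>j\<in>{0..<k}. (real_of_int j)\<^sup>2 / (real_of_int k)\<^sup>2 - real_of_int j / real_of_int k + 1 / 4)"
    by (rule sum.cong) (simp_all add: saw_def power2_diff power_divide power2_eq_square[of "1 / 2"])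
  also have "\<dots> = real_of_int k / 12 + 1 / (6 * real_of_int k)"
    using assms
    by (simp add: sum_subtractf sum.distrib sum_divide_distrib[symmetric] sum_int_real
        sum_int_real_squares)
      (simp add: field_simps power2_eq_square)
  finally show ?thesis .
qed

text \<open>This is the distribution relation: the sum of ((w + j/h)) over j modulo h equals ((hw)),
  here with w = p/(hk).\<close>

lemma sum_saw_affine:
  assumes "h > 0" "k > 0" "coprime u h"
  shows "(\<Sum>j\<in>{0..<h}. saw (p + k * (u * j + r)) (h * k)) = saw p k"
proof -
  \<comment> \<open>The quotient \<open>p div k\<close> is moved into the index, which is then
    reduced modulo h; the argument now lies in [0, hk) and the sawtooth can be evaluated.\<close>
  have c: "saw (p + k * y) (h * k) = saw (p mod k + k * ((y + p div k) mod h)) (h * k)" for y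
  proof (rule saw_cong)
    have "p + k * y = p mod k + k * (y + p div k)"
      by (simp add: algebra_simps)
    also have "[\<dots> = p mod k + k * ((y + p div k) mod h)] (mod (h * k))"
      by (subst (2) mult.commute) (intro cong_add cong_cmult_leftI; simp add: cong_def)
    finally show "[p + k * y = p mod k + k * ((y + p div k) mod h)] (mod (h * k))" .
  qed
  have "(\<Sum>j\<in>{0..<h}. saw (p + k * (u * j + r)) (h * k))
      = (\<Sum>j\<in>{0..<h}. saw (p mod k + k * ((u * j + (r + p div k)) mod h)) (h * k))"
    by (subst c) (simp add: add.assoc)
  also have "\<dots> = (\<Sum>j\<in>{0..<h}. saw (p mod k + k * j) (h * k))"
    by (rule sum_affine_mod[where f = "\<lambda>i. saw (p mod k + k * i) (h * k)", OF assms(1) assms(3)])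
  also have "\<dots> = (\<Sum>j\<in>{0..<h}. real_of_int (p mod k) / (h * k) - 1 / 2 + real_of_int j / h)"
  proof (rule sum.cong)
    fix j assume j: "j \<in> {0..<h}"
    have "p mod k + k * j < k * (j + 1)" using assms by (simp add: algebra_simps)
    also have "\<dots> \<le> k * h" using assms j by (intro mult_left_mono) auto
    finally have "(p mod k + k * j) mod (h * k) = p mod k + k * j"
      using assms j by (intro mod_pos_pos_trivial) (auto simp: mult.commute)
    then show "saw (p mod k + k * j) (h * k) = real_of_int (p mod k) / (h * k) - 1 / 2 + real_of_int j / h"
      using assms by (simp add: saw_def field_simps)
  qed simp
  also have "\<dots> = saw p k"
    using assms
    by (simp add: sum.distrib sum_divide_distrib[symmetric] sum_int_real saw_def)
      (simp add: field_simps)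
  finally show ?thesis .
qed

text \<open>
  With U, V, W the sawtooth values at m/k, j/h and (hm + kj + t)/(hk), the integer
  U + V + 1/2 + t/(hk) - W is 0 or 1, so its distance to 1/2 is constant; the reciprocity law
  is this identity summed over all m and j.
\<close>
lemma dedekind_sum_reciprocity:
  assumes hk: "h > 0" "k > 0" "coprime h k" and t: "0 \<le> t" "t < h + k"
  shows "dedekind_sum t h k + dedekind_sum t k h =
    ((real_of_int h)\<^sup>2 + (real_of_int k)\<^sup>2 + 1) / (12 * h * k) + 1 / 4
    + (real_of_int t)\<^sup>2 / (2 * h * k) - t * (real_of_int h + k - 1) / (2 * h * k)"
proof -
  define T where "T = real_of_int t / (h * k)"
  define W where "W m j = saw (t + h * m + k * j) (h * k)" for m j
  have one: "(saw m k + saw j h - W m j + T)\<^sup>2 = 1 / 4" if "m \<in> {0..<k}" "j \<in> {0..<h}" for m j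
  proof -
    let ?N = "t + h * m + k * j"
    let ?q = "?N div (h * k)"
    have "h * m \<le> h * (k - 1)" "k * j \<le> k * (h - 1)"
      using that hk by (auto intro!: mult_left_mono)
    \<comment> \<open>The largest value of \<open>?N\<close> is t + 2hk - h - k, so this is where t
      < h + k enters.\<close>
    then have "?N < 2 * (h * k)" using t by (simp add: algebra_simps)
    moreover have "?N \<ge> 0" using that hk t by simp
    moreover have "?N = h * k * ?q + ?N mod (h * k)" "0 \<le> ?N mod (h * k)" "?N mod (h * k) < h * k"
      using hk by simp_all
    ultimately have "h * k * (- 1) < h * k * ?q" "h * k * ?q < h * k * 2"
      by linarith+
    then have "- 1 < ?q" "?q < 2"
      using hk by (simp_all only: mult_less_cancel_left_pos mult_pos_pos)
    then have "?q = 0 \<or> ?q = 1" by linarith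
    moreover have "saw m k + saw j h - W m j + T = real_of_int ?q - 1 / 2"
    proof -
      have "real_of_int ?N = real_of_int (?N mod (h * k)) + real_of_int (h * k) * real_of_int ?q"
        by (metis of_int_add of_int_mult mult_div_mod_eq add.commute)
      then have r: "real_of_int (?N mod (h * k)) = t + h * m + k * j - h * k * real_of_int ?q"
        by simp
      have "W m j = (t + h * m + k * j - h * k * real_of_int ?q) / (h * k) - 1 / 2"
        unfolding W_def saw_def r by simp
      moreover have "saw m k = m / k - 1 / 2" "saw j h = j / h - 1 / 2"
        using that by (simp_all add: saw_def)
      ultimately show ?thesis
        using hk by (simp only: T_def) (simp add: field_simps)
    qed
    ultimately show ?thesis by (auto simp: power2_eq_square)
  qed
  have W2: "(\<Sum>m\<in>{0..<k}. \<Sum>j\<in>{0..<h}. (W m j)\<^sup>2) = h * k / 12 + 1 / (6 * h * k)"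
    using sum_crt[OF hk, of 1 1 "\<lambda>i. (saw i (h * k))\<^sup>2" t 0 0] sum_saw_squares[of "h * k"] hk
    by (simp add: W_def)
  \<comment> \<open>Summing out one index collapses \<open>W\<close> to a sawtooth modulo k or
    modulo h; this turns the mixed sums \<open>UW\<close> and \<open>VW\<close> into the two
    Dedekind sums.\<close>
  have Wj: "(\<Sum>j\<in>{0..<h}. W m j) = saw (h * m + t) k" for m
    using sum_saw_affine[of h k 1 "t + h * m" 0] hk by (simp add: W_def add.commute)
  have Wm: "(\<Sum>m\<in>{0..<k}. W m j) = saw (k * j + t) h" for j
    using sum_saw_affine[of k h 1 "t + k * j" 0] hk by (simp add: W_def algebra_simps)
  have Wt: "(\<Sum>m\<in>{0..<k}. \<Sum>j\<in>{0..<h}. W m j) = - 1 / 2"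
    using sum_crt[OF hk, of 1 1 "\<lambda>i. saw i (h * k)" t 0 0] sum_saw[of "h * k"] hk
    by (simp add: W_def)
  have UW: "(\<Sum>m\<in>{0..<k}. \<Sum>j\<in>{0..<h}. saw m k * W m j) = dedekind_sum t h k"
    by (simp add: sum_distrib_left[symmetric] Wj dedekind_sum_def mult.commute)
  have VW: "(\<Sum>m\<in>{0..<k}. \<Sum>j\<in>{0..<h}. saw j h * W m j) = dedekind_sum t k h"
    by (subst sum.swap) (simp add: sum_distrib_left[symmetric] Wm dedekind_sum_def mult.commute)
  have UV: "(\<Sum>m\<in>{0..<k}. \<Sum>j\<in>{0..<h}. saw m k * saw j h) = 1 / 4"
    using hk by (simp add: sum_product[symmetric] sum_saw)
  have scale: "(\<Sum>m\<in>{0..<k}. \<Sum>j\<in>{0..<h}. c * f m j) = c * (\<Sum>m\<in>{0..<k}. \<Sum>j\<in>{0..<h}. f m j)"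
    for c :: real and f
    by (simp add: sum_distrib_left)
  have U: "(\<Sum>m\<in>{0..<k}. \<Sum>j\<in>{0..<h}. saw m k) = - h / 2"
    "(\<Sum>m\<in>{0..<k}. \<Sum>j\<in>{0..<h}. (saw m k)\<^sup>2) = h * (k / 12 + 1 / (6 * k))"
    using hk by (simp_all add: sum_distrib_left[symmetric] sum_saw sum_saw_squares)
  have V: "(\<Sum>m\<in>{0..<k}. \<Sum>j\<in>{0..<h}. saw j h) = - k / 2"
    "(\<Sum>m\<in>{0..<k}. \<Sum>j\<in>{0..<h}. (saw j h)\<^sup>2) = k * (h / 12 + 1 / (6 * h))"
    using hk by (simp_all add: sum_saw sum_saw_squares)
  have T: "(\<Sum>m\<in>{0..<k}. \<Sum>j\<in>{0..<h}. T\<^sup>2) = h * k * T\<^sup>2"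
    using hk by simp
  have "h * k / 4 = (\<Sum>m\<in>{0..<k}. \<Sum>j\<in>{0..<h}. (saw m k + saw j h - W m j + T)\<^sup>2)"
    using hk by (simp add: one)
  also have "\<dots> = (\<Sum>m\<in>{0..<k}. \<Sum>j\<in>{0..<h}. (saw m k)\<^sup>2 + (saw j h)\<^sup>2 + (W m j)\<^sup>2
      + 2 * (saw m k * saw j h) - 2 * (saw m k * W m j) - 2 * (saw j h * W m j)
      + 2 * T * saw m k + 2 * T * saw j h - 2 * T * W m j + T\<^sup>2)"
    by (intro sum.cong refl) (simp add: power2_eq_square algebra_simps)
  also have "\<dots> = h * (k / 12 + 1 / (6 * k)) + k * (h / 12 + 1 / (6 * h)) + (h * k / 12 + 1 / (6 * h * k))
      + 2 * (1 / 4) - 2 * dedekind_sum t h k - 2 * dedekind_sum t k h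
      + 2 * T * (- h / 2) + 2 * T * (- k / 2) - 2 * T * (- 1 / 2) + h * k * T\<^sup>2"
    by (simp only: sum.distrib sum_subtractf scale U V T W2 Wt UW VW UV)
  finally have "dedekind_sum t h k + dedekind_sum t k h =
      (h * (k / 12 + 1 / (6 * k)) + k * (h / 12 + 1 / (6 * h)) + (h * k / 12 + 1 / (6 * h * k))
      + 1 / 2 - T * h - T * k + T + h * k * T\<^sup>2 - h * k / 4) / 2"
    by (simp add: algebra_simps)
  also have "\<dots> = ((real_of_int h)\<^sup>2 + (real_of_int k)\<^sup>2 + 1) / (12 * real_of_int h * k) + 1 / 4
    + (real_of_int t)\<^sup>2 / (2 * real_of_int h * k)
    - t * (real_of_int h + k - 1) / (2 * real_of_int h * k)"
    using hk unfolding T_def by (simp add: field_simps power2_eq_square)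
  finally show ?thesis .
qed

section \<open>Bounds for Dedekind sums\<close>

lemma dedekind_sum_mod: "dedekind_sum (t mod k) h k = dedekind_sum t h k"
  by (rule dedekind_sum_cong) (simp_all add: cong_def)

text \<open>From -uv \<le> (u^2 + v^2)/2 termwise. As h is a unit modulo k, both sums of squares are
  the full second moment.\<close>

lemma dedekind_sum_ge_trivial:
  assumes "k > 0" "coprime h k"
  shows "- (real_of_int k / 12 + 1 / (6 * real_of_int k)) \<le> dedekind_sum t h k"
proof -
  have "- dedekind_sum t h k \<le> (\<Sum>m\<in>{0..<k}. ((saw (h * m + t) k)\<^sup>2 + (saw m k)\<^sup>2) / 2)"
    unfolding dedekind_sum_def sum_negf[symmetric]
  proof (rule sum_mono)
    fix m
    show "- (saw (h * m + t) k * saw m k) \<le> ((saw (h * m + t) k)\<^sup>2 + (saw m k)\<^sup>2) / 2"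
      using zero_le_power2[of "saw (h * m + t) k + saw m k"] by (simp add: power2_sum)
  qed
  also have "\<dots> = ((\<Sum>m\<in>{0..<k}. (saw (h * m + t) k)\<^sup>2) + (\<Sum>m\<in>{0..<k}. (saw m k)\<^sup>2)) / 2"
    by (simp add: sum_divide_distrib[symmetric] sum.distrib)
  also have "(\<Sum>m\<in>{0..<k}. (saw (h * m + t) k)\<^sup>2) = (\<Sum>m\<in>{0..<k}. (saw m k)\<^sup>2)"
    using sum_affine_mod[OF assms, where f = "\<lambda>i. (saw i k)\<^sup>2" and r = t] by simp
  finally show ?thesis
    using assms by (simp add: sum_saw_squares)
qed

text \<open>After reducing the shift to x in [0, k-1], reciprocity applies and x enters only through
  the quadratic x^2 - x(h+k-1) over 2hk. The two bounds come from estimating this quadratic.\<close>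

lemma
  assumes hk: "h > 0" "k > 0" "coprime h k"
  shows dedekind_sum_ge: "dedekind_sum t h k \<ge>
      real_of_int h / (12 * k) + 1 / (12 * real_of_int h * k) - real_of_int k / (24 * h) - 1 / 4
      - dedekind_sum (t mod k) k h"
    and dedekind_sum_le: "dedekind_sum t h k \<le>
      real_of_int h / (12 * k) + real_of_int k / (12 * h) + 1 / (12 * real_of_int h * k) + 1 / 4
      - dedekind_sum (t mod k) k h"
proof -
  define x where "x = real_of_int (t mod k)"
  have "t mod k \<le> k - 1"
    using hk pos_mod_bound[of k t] by linarith
  then have "x \<le> real_of_int (k - 1)"
    unfolding x_def by (simp only: of_int_le_iff)
  then have x: "0 \<le> x" "x \<le> k - 1"
    using hk unfolding x_def by simp_all
  have hk1: "real_of_int h \<ge> 1" "real_of_int k \<ge> 1"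
    using hk by simp_all
  have "t mod k < h + k"
    using hk pos_mod_bound[of k t] by linarith
  then have "dedekind_sum t h k + dedekind_sum (t mod k) k h =
      ((real_of_int h)\<^sup>2 + (real_of_int k)\<^sup>2 + 1) / (12 * h * k) + 1 / 4
      + x\<^sup>2 / (2 * h * k) - x * (real_of_int h + k - 1) / (2 * h * k)"
    using dedekind_sum_reciprocity[OF hk, of "t mod k"] hk by (simp add: dedekind_sum_mod x_def)
  also have "\<dots> = real_of_int h / (12 * k) + real_of_int k / (12 * h) + 1 / (12 * real_of_int h * k)
      + 1 / 4 + (x\<^sup>2 - x * (real_of_int h + k - 1)) / (2 * real_of_int h * k)"
    using hk by (simp add: field_simps power2_eq_square)
  finally have eq: "dedekind_sum t h k + dedekind_sum (t mod k) k h = \<dots>" .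
  have "x * x \<le> x * (real_of_int h + k - 1)"
    using x hk1 by (intro mult_left_mono) auto
  then have "(x\<^sup>2 - x * (real_of_int h + k - 1)) / (2 * real_of_int h * k) \<le> 0"
    using hk1 by (simp add: divide_le_0_iff power2_eq_square)
  with eq show "dedekind_sum t h k \<le>
      real_of_int h / (12 * k) + real_of_int k / (12 * h) + 1 / (12 * real_of_int h * k) + 1 / 4
      - dedekind_sum (t mod k) k h"
    by linarith
  \<comment> \<open>The quadratic splits as (x^2 - kx) - x(h-1), bounded below by -k^2/4 and -hk
    respectively.\<close>
  have "x * (real_of_int h - 1) \<le> k * real_of_int h"
    using x hk1 by (intro mult_mono) auto
  moreover have "0 \<le> (2 * x - k)\<^sup>2" by simp
  ultimately have "- (real_of_int k)\<^sup>2 / 4 - real_of_int k * h \<le> x\<^sup>2 - x * (real_of_int h + k - 1)"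
    by (simp add: power2_diff algebra_simps)
  then have "(- (real_of_int k)\<^sup>2 / 4 - real_of_int k * h) / (2 * real_of_int h * k)
      \<le> (x\<^sup>2 - x * (real_of_int h + k - 1)) / (2 * real_of_int h * k)"
    using hk1 by (intro divide_right_mono) auto
  moreover have "(- (real_of_int k)\<^sup>2 / 4 - real_of_int k * h) / (2 * real_of_int h * k)
      = - real_of_int k / (8 * h) - 1 / 2"
    using hk by (simp add: field_simps power2_eq_square)
  \<comment> \<open>This is 1/12 - 1/8 = -1/24; likewise the constant is 1/4 - 1/2 = -1/4.\<close>
  moreover have "real_of_int k / (12 * h) - real_of_int k / (8 * h) = - real_of_int k / (24 * h)"
    using hk by (simp add: field_simps)
  ultimately show "dedekind_sum t h k \<ge>
      real_of_int h / (12 * k) + 1 / (12 * real_of_int h * k) - real_of_int k / (24 * h) - 1 / 4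
      - dedekind_sum (t mod k) k h"
    using eq by linarith
qed

text \<open>For h = 1 the reciprocal sum has the single term (-1/2)^2 = 1/4, so reciprocity
  evaluates the sum exactly. The bounds are the extremes -k^2/4 and 0 of x^2 - kx on [0, k], divided
  by 2k.\<close>

lemma
  assumes k: "k > 0"
  shows dedekind_sum_1_ge: "dedekind_sum t 1 k \<ge> - real_of_int k / 24 + 1 / (6 * real_of_int k)"
    and dedekind_sum_1_le: "dedekind_sum t 1 k \<le> real_of_int k / 12 + 1 / (6 * real_of_int k)"
proof -
  define x where "x = real_of_int (t mod k)"
  have x: "0 \<le> x" "x \<le> k"
    using k pos_mod_bound[of k t] unfolding x_def by (simp_all add: less_imp_le)
  have "{0..<1::int} = {0}" by auto
  then have "dedekind_sum (t mod k) k 1 = 1 / 4"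
    by (simp add: dedekind_sum_def saw_def)
  moreover have "t mod k < 1 + k"
    using k pos_mod_bound[of k t] by linarith
  ultimately have "dedekind_sum t 1 k =
      (1 + (real_of_int k)\<^sup>2 + 1) / (12 * k) + x\<^sup>2 / (2 * k) - x * k / (2 * k)"
    using dedekind_sum_reciprocity[of 1 k "t mod k"] k
    by (simp add: dedekind_sum_mod x_def)
  also have "\<dots> = real_of_int k / 12 + 1 / (6 * real_of_int k) + (x\<^sup>2 - x * k) / (2 * k)"
    using k by (simp add: field_simps power2_eq_square)
  finally have eq: "dedekind_sum t 1 k = \<dots>" .
  have "x * x \<le> x * k"
    using x by (intro mult_left_mono) auto
  then have "(x\<^sup>2 - x * k) / (2 * k) \<le> 0"
    using k by (simp add: divide_le_0_iff power2_eq_square)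
  with eq show "dedekind_sum t 1 k \<le> real_of_int k / 12 + 1 / (6 * real_of_int k)"
    by linarith
  have "0 \<le> (2 * x - k)\<^sup>2" by simp
  then have "- (real_of_int k)\<^sup>2 / 4 \<le> x\<^sup>2 - x * k"
    by (simp add: power2_diff)
  then have "(- (real_of_int k)\<^sup>2 / 4) / (2 * k) \<le> (x\<^sup>2 - x * k) / (2 * k)"
    using k by (intro divide_right_mono) auto
  moreover have "(- (real_of_int k)\<^sup>2 / 4) / (2 * k) = - real_of_int k / 8"
    using k by (simp add: field_simps power2_eq_square)
  ultimately show "dedekind_sum t 1 k \<ge> - real_of_int k / 24 + 1 / (6 * real_of_int k)"
    using eq by linarith
qed

text \<open>The cases follow the Euclidean algorithm z, h = z1, w = z2. Reciprocity leads from
  modulus z to modulus h, where z may be replaced by w; the sign flips, so an upper bound is needed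
  there. A second reciprocity leads to modulus w. A slope equal to 1 stops the descent with the
  exact evaluation.\<close>

lemma L_le_dedekind_sum:
  assumes z: "z \<ge> 2" and cop: "coprime x z" "coprime y z"
  shows "L x y z \<le> dedekind_sum t (- modular_inverse z x * y) z"
proof -
  define h where "h = (- modular_inverse z x * y) mod z"
  define w where "w = z mod h"
  have eq: "dedekind_sum t (- modular_inverse z x * y) z = dedekind_sum t h z"
    by (rule dedekind_sum_cong) (simp_all add: h_def cong_def)
  have cop_h: "coprime h z"
    using cop z by (simp add: h_def coprime_mod_left_iff)
  have "h \<ge> 0"
    using z by (simp add: h_def)
  moreover have "h \<noteq> 0"
    using z cop_h by auto
  ultimately have h0: "h > 0" by simp
  note L = L_def[of x y z, unfolded Let_def, folded h_def, folded w_def]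
  consider "h = 1" | "h \<noteq> 1" "w = 1" | "h \<noteq> 1" "w \<noteq> 1" by blast
  then show ?thesis
  proof cases
    case 1
    then have "L x y z = - real_of_int z / 24 + 1 / (6 * real_of_int z) - 3 / 4"
      by (simp add: L)
    moreover have "dedekind_sum t h z \<ge> - real_of_int z / 24 + 1 / (6 * real_of_int z)"
      using dedekind_sum_1_ge[of z t] z 1 by simp
    ultimately show ?thesis using eq by linarith
  next
    case 2
    then have L2: "L x y z = real_of_int h / (12 * z) + 1 / (12 * real_of_int h * z)
        - real_of_int z / (24 * h) - 1 / (6 * real_of_int h) - real_of_int h / 12 - 3 / 4"
      by (simp add: L)
    have "dedekind_sum (t mod z) z h = dedekind_sum (t mod z) 1 h"
      by (rule dedekind_sum_cong) (use 2 h0 in \<open>simp_all add: cong_def w_def\<close>)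
    also have "\<dots> \<le> real_of_int h / 12 + 1 / (6 * real_of_int h)"
      by (rule dedekind_sum_1_le) fact
    finally show ?thesis
      using dedekind_sum_ge[of h z t] h0 z cop_h L2 eq by simp
  next
    case 3
    \<comment> \<open>\<open>E\<close> is the second moment modulo w, hence the trivial bound for
      the last sum; the radicand in \<open>L\<close> is E(E - 1/4).\<close>
    define E where "E = real_of_int w / 12 + 1 / (6 * real_of_int w)"
    have "real_of_int w / 12 - 1 / 4 + 1 / (6 * real_of_int w) = E - 1 / 4"
      by (simp add: E_def)
    then have L3: "L x y z = real_of_int h / (12 * z) + 1 / (12 * real_of_int h * z)
        - real_of_int z / (24 * h) - real_of_int w / (12 * h)
        - 1 / (12 * real_of_int h * w) - real_of_int h / (12 * w) - 3 / 4 - sqrt (E * (E - 1 / 4))"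
      using 3 by (simp add: L flip: E_def)
    have cop_w: "coprime w h"
      using cop_h h0 by (simp add: w_def coprime_mod_left_iff coprime_commute)
    have "w \<ge> 0"
      using h0 by (simp add: w_def)
    moreover have "w \<noteq> 0"
      using 3 h0 cop_w by auto
    ultimately have w: "w \<ge> 2"
      using 3 by simp
    \<comment> \<open>The product equals 12w(E - 1/4).\<close>
    have "0 \<le> (real_of_int w - 1) * (real_of_int w - 2)"
      using w by simp
    then have "E \<ge> 1 / 4"
      using w unfolding E_def by (simp add: field_simps)
    \<comment> \<open>Each reciprocity costs 1/4 and the last sum costs \<open>E\<close>, in total
      1/2 + E = 3/4 + (E - 1/4). Replacing E - 1/4 by the root gives the form of
      \<open>L\<close>.\<close>
    then have "E - 1 / 4 \<le> sqrt (E * (E - 1 / 4))"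
      by (intro real_le_rsqrt) (simp add: power2_eq_square mult_right_mono)
    moreover have "dedekind_sum (t mod z) z h = dedekind_sum (t mod z) w h"
      by (rule dedekind_sum_cong) (simp_all add: cong_def w_def)
    moreover have "- dedekind_sum (t mod z mod h) h w \<le> E"
      using dedekind_sum_ge_trivial[of w h "t mod z mod h"] w cop_w by (simp add: E_def coprime_commute)
    ultimately show ?thesis
      using dedekind_sum_ge[of h z t] dedekind_sum_le[of w h "t mod z"] h0 z w cop_h cop_w L3 eq
      by (simp add: mult.commute mult.left_commute)
  qed
qed

section \<open>Coefficients modulo bc from the Chinese remainder theorem\<close>

text \<open>A solution i of i = y modulo b and ai + bz = n modulo c, left unreduced modulo bc. It is
  the coefficient of a; rotating (a,b,c) and (x,y,z) cyclically gives those of b and c. Each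
  coefficient involves only two of the three residues.\<close>

definition crt_coeff :: "int \<Rightarrow> int \<Rightarrow> int \<Rightarrow> int \<Rightarrow> int \<Rightarrow> int \<Rightarrow> int" where
  "crt_coeff a b c n y z =
    c * (modular_inverse b c * y) + b * (modular_inverse c b * (modular_inverse c a * (n - b * z)))"

context
  fixes a b c :: int
  assumes pos: "a > 0" "b > 0" "c > 0"
    and cop: "coprime a b" "coprime b c" "coprime a c"
begin

lemma crt_coeff_cong_left: "[crt_coeff a b c n y z = y] (mod b)"
proof -
  have "[c * modular_inverse b c * y + b * (modular_inverse c b * (modular_inverse c a * (n - b * z)))
      = 1 * y + 0] (mod b)"
    using cop by (intro cong_add cong_mult cong_modular_inverse1 cong_refl)
      (simp_all add: coprime_commute cong_def)
  then show ?thesis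
    by (simp add: crt_coeff_def mult.assoc)
qed

lemma crt_coeff_cong_right: "[a * crt_coeff a b c n y z + b * z = n] (mod c)"
proof -
  have "[a * modular_inverse c a * (b * modular_inverse c b) * (n - b * z)
      + c * (a * modular_inverse b c * y) + b * z = 1 * 1 * (n - b * z) + 0 + b * z] (mod c)"
    using cop by (intro cong_add cong_mult cong_modular_inverse1 cong_refl)
      (simp_all add: cong_def)
  then show ?thesis
    by (simp add: crt_coeff_def algebra_simps)
qed

text \<open>The shape required by \<open>sum_crt\<close> and \<open>sum_saw_affine\<close>, with
  unit slopes in y modulo b and in z modulo c.\<close>

lemma crt_coeff_affine:
  "crt_coeff a b c n y z = c * (modular_inverse b c * y)
    + b * (- (modular_inverse c b * modular_inverse c a * b) * z
           + modular_inverse c b * modular_inverse c a * n)"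
  by (simp add: crt_coeff_def algebra_simps)

lemma coprime_crt_coeff_factors:
  "coprime (modular_inverse b c) b"
  "coprime (- (modular_inverse c b * modular_inverse c a * b)) c"
  using cop coprime_commute[of b c] by simp_all

text \<open>The distribution relation in y keeps only the residue a^{-1}(n - bz) modulo c. This is
  one factor of a Dedekind sum modulo c; the other comes from \<open>sum_saw_crt_coeff_right\<close>
  for the rotated triple.\<close>

lemma sum_saw_crt_coeff_left:
  "(\<Sum>y\<in>{0..<b}. saw (crt_coeff a b c n y z) (b * c)) = saw (- modular_inverse c a * b * z + modular_inverse c a * n) c"
proof -
  let ?w = "modular_inverse c a * (n - b * z)"
  have "(\<Sum>y\<in>{0..<b}. saw (crt_coeff a b c n y z) (b * c)) = saw (b * (modular_inverse c b * ?w)) c"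
    using sum_saw_affine[OF pos(2,3) coprime_crt_coeff_factors(1), of "b * (modular_inverse c b * ?w)" 0]
    by (simp add: crt_coeff_def add.commute)
  also have "\<dots> = saw ?w c"
  proof (rule saw_cong)
    have "[b * modular_inverse c b * ?w = 1 * ?w] (mod c)"
      using cop by (intro cong_mult cong_modular_inverse1 cong_refl)
    then show "[b * (modular_inverse c b * ?w) = ?w] (mod c)"
      by (simp add: mult.assoc)
  qed
  finally show ?thesis
    by (simp add: algebra_simps)
qed

lemma sum_saw_crt_coeff_right:
  "(\<Sum>z\<in>{0..<c}. saw (crt_coeff a b c n y z) (b * c)) = saw y b"
proof -
  have "(\<Sum>z\<in>{0..<c}. saw (crt_coeff a b c n y z) (b * c)) = saw (c * (modular_inverse b c * y)) b"
    unfolding crt_coeff_affine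
    using sum_saw_affine[OF pos(3,2) coprime_crt_coeff_factors(2)] by (simp only: mult.commute[of b c])
  also have "\<dots> = saw y b"
  proof (rule saw_cong)
    have "[c * modular_inverse b c * y = 1 * y] (mod b)"
      using cop by (intro cong_mult cong_modular_inverse1 cong_refl) (simp add: coprime_commute)
    then show "[c * (modular_inverse b c * y) = y] (mod b)"
      by (simp add: mult.assoc)
  qed
  finally show ?thesis .
qed

lemma sum_crt_coeff:
  fixes f :: "int \<Rightarrow> 'a::comm_monoid_add"
  shows "(\<Sum>y\<in>{0..<b}. \<Sum>z\<in>{0..<c}. f (crt_coeff a b c n y z mod (b * c))) = (\<Sum>i\<in>{0..<b * c}. f i)"
  using sum_crt[OF pos(3,2) _ coprime_crt_coeff_factors(2,1), of f 0 0
      "modular_inverse c b * modular_inverse c a * n"] cop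
  unfolding crt_coeff_affine by (simp add: mult.commute[of b c] coprime_commute)

end

section \<open>The quadratic equation satisfied by a nonrepresentable number\<close>

text \<open>Any two of \<open>U\<close>, \<open>V\<close>, \<open>W\<close> share exactly one
  variable. With it fixed, the sum of their product over the other two variables factorises.\<close>

lemma sum_square_three:
  fixes A :: "'a set" and B :: "'b set" and C :: "'c set" and N :: real
    and U :: "'b \<Rightarrow> 'c \<Rightarrow> real" and V :: "'c \<Rightarrow> 'a \<Rightarrow> real" and W :: "'a \<Rightarrow> 'b \<Rightarrow> real"
  shows "(\<Sum>x\<in>A. \<Sum>y\<in>B. \<Sum>z\<in>C. (N - U y z - V z x - W x y)\<^sup>2)
    = card A * card B * card C * N\<^sup>2
      - 2 * N * (card A * (\<Sum>y\<in>B. \<Sum>z\<in>C. U y z) + card B * (\<Sum>z\<in>C. \<Sum>x\<in>A. V z x)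
                 + card C * (\<Sum>x\<in>A. \<Sum>y\<in>B. W x y))
      + card A * (\<Sum>y\<in>B. \<Sum>z\<in>C. (U y z)\<^sup>2) + card B * (\<Sum>z\<in>C. \<Sum>x\<in>A. (V z x)\<^sup>2)
      + card C * (\<Sum>x\<in>A. \<Sum>y\<in>B. (W x y)\<^sup>2)
      + 2 * ((\<Sum>z\<in>C. (\<Sum>y\<in>B. U y z) * (\<Sum>x\<in>A. V z x))
           + (\<Sum>x\<in>A. (\<Sum>z\<in>C. V z x) * (\<Sum>y\<in>B. W x y))
           + (\<Sum>y\<in>B. (\<Sum>x\<in>A. W x y) * (\<Sum>z\<in>C. U y z)))"
proof -
  define S :: "('a \<Rightarrow> 'b \<Rightarrow> 'c \<Rightarrow> real) \<Rightarrow> real"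
    where "S f = (\<Sum>x\<in>A. \<Sum>y\<in>B. \<Sum>z\<in>C. f x y z)" for f
  have add: "S (\<lambda>x y z. f x y z + g x y z) = S f + S g" for f g
    by (simp add: S_def sum.distrib)
  have scale: "S (\<lambda>x y z. k * f x y z) = k * S f" for k :: real and f
    by (simp add: S_def sum_distrib_left)
  have N: "S (\<lambda>x y z. N\<^sup>2) = card A * card B * card C * N\<^sup>2"
    by (simp add: S_def)
  have U: "S (\<lambda>x y z. f y z) = card A * (\<Sum>y\<in>B. \<Sum>z\<in>C. f y z)" for f :: "'b \<Rightarrow> 'c \<Rightarrow> real"
    by (simp add: S_def)
  have V: "S (\<lambda>x y z. f z x) = card B * (\<Sum>z\<in>C. \<Sum>x\<in>A. f z x)" for f :: "'c \<Rightarrow> 'a \<Rightarrow> real"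
    by (simp add: S_def sum_distrib_left[symmetric]) (intro disjI2 sum.swap)
  have W: "S (\<lambda>x y z. f x y) = card C * (\<Sum>x\<in>A. \<Sum>y\<in>B. f x y)" for f :: "'a \<Rightarrow> 'b \<Rightarrow> real"
    by (simp add: S_def sum_distrib_left[symmetric])
  have VW: "S (\<lambda>x y z. V z x * W x y) = (\<Sum>x\<in>A. (\<Sum>z\<in>C. V z x) * (\<Sum>y\<in>B. W x y))"
    unfolding S_def by (subst sum.swap) (simp add: sum_product)
  have WU: "S (\<lambda>x y z. W x y * U y z) = (\<Sum>y\<in>B. (\<Sum>x\<in>A. W x y) * (\<Sum>z\<in>C. U y z))"
    unfolding S_def by (subst sum.swap) (simp add: sum_product)
  have UV: "S (\<lambda>x y z. U y z * V z x) = (\<Sum>z\<in>C. (\<Sum>y\<in>B. U y z) * (\<Sum>x\<in>A. V z x))"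
  proof -
    have "S (\<lambda>x y z. U y z * V z x) = (\<Sum>x\<in>A. \<Sum>z\<in>C. (\<Sum>y\<in>B. U y z) * V z x)"
      unfolding S_def sum_distrib_right by (intro sum.cong refl sum.swap)
    also have "\<dots> = (\<Sum>z\<in>C. (\<Sum>y\<in>B. U y z) * (\<Sum>x\<in>A. V z x))"
      unfolding sum_distrib_left by (rule sum.swap)
    finally show ?thesis .
  qed
  have "S (\<lambda>x y z. (N - U y z - V z x - W x y)\<^sup>2)
    = S (\<lambda>x y z. N\<^sup>2 + (- 2 * N) * U y z + (- 2 * N) * V z x + (- 2 * N) * W x y
        + (U y z)\<^sup>2 + (V z x)\<^sup>2 + (W x y)\<^sup>2
        + 2 * (U y z * V z x) + 2 * (V z x * W x y) + 2 * (W x y * U y z))"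
    unfolding S_def by (intro sum.cong refl) (simp add: power2_eq_square algebra_simps)
  also have "\<dots> = card A * card B * card C * N\<^sup>2
      + (- 2 * N) * (card A * (\<Sum>y\<in>B. \<Sum>z\<in>C. U y z))
      + (- 2 * N) * (card B * (\<Sum>z\<in>C. \<Sum>x\<in>A. V z x))
      + (- 2 * N) * (card C * (\<Sum>x\<in>A. \<Sum>y\<in>B. W x y))
      + card A * (\<Sum>y\<in>B. \<Sum>z\<in>C. (U y z)\<^sup>2) + card B * (\<Sum>z\<in>C. \<Sum>x\<in>A. (V z x)\<^sup>2)
      + card C * (\<Sum>x\<in>A. \<Sum>y\<in>B. (W x y)\<^sup>2)
      + 2 * S (\<lambda>x y z. U y z * V z x) + 2 * S (\<lambda>x y z. V z x * W x y) + 2 * S (\<lambda>x y z. W x y * U y z)"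
    unfolding add scale N
    unfolding U[of U] V[of V] W[of W] U[of "\<lambda>y z. (U y z)\<^sup>2"] V[of "\<lambda>z x. (V z x)\<^sup>2"]
      W[of "\<lambda>x y. (W x y)\<^sup>2"] ..
  finally show ?thesis
    unfolding UV VW WU unfolding S_def by (simp add: distrib_left)
qed

text \<open>
  For residues x, y, z modulo a, b, c let i1, i2, i3 be the values of crt_coeff reduced modulo
  bc, ca, ab.  Then a i1 + b i2 + c i3 = n - abc J with an integer J.  If n is not representable
  then J is negative, and by size J = -1 or J = -2, whence (J + 3/2)^2 = 1/4.
\<close>
lemma nonrepresentable_square:
  fixes a b c n x y z :: int
  assumes pos: "a > 0" "b > 0" "c > 0"
    and cop: "coprime a b" "coprime b c" "coprime a c"
    and n: "n > - (a + b + c)" "\<not> representable3 a b c n"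
  shows "(real_of_int n / (a * b * c) - saw (crt_coeff a b c n y z) (b * c)
    - saw (crt_coeff b c a n z x) (c * a) - saw (crt_coeff c a b n x y) (a * b))\<^sup>2 = 1 / 4"
proof -
  have cop': "coprime b a" "coprime c b" "coprime c a"
    using cop by (simp_all add: coprime_commute)
  define p q r where "p = crt_coeff a b c n y z" and "q = crt_coeff b c a n z x"
    and "r = crt_coeff c a b n x y"
  define i j k where "i = p mod (b * c)" and "j = q mod (c * a)" and "k = r mod (a * b)"
  note left = crt_coeff_cong_left[OF pos cop, of n y z, folded p_def]
    crt_coeff_cong_left[OF pos(2,3,1) cop(2) cop'(3) cop'(1), of n z x, folded q_def]
    crt_coeff_cong_left[OF pos(3,1,2) cop'(3) cop(1) cop'(2), of n x y, folded r_def]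
  note right = crt_coeff_cong_right[OF pos cop, of n y z, folded p_def]
    crt_coeff_cong_right[OF pos(2,3,1) cop(2) cop'(3) cop'(1), of n z x, folded q_def]
    crt_coeff_cong_right[OF pos(3,1,2) cop'(3) cop(1) cop'(2), of n x y, folded r_def]
  note diff = left[THEN cong_diff_iff_cong_0[THEN iffD2]]
  have "[a * i + b * j + c * k = a * p + b * q + c * r] (mod (a * b * c))"
  proof (intro cong_add)
    show "[a * i = a * p] (mod (a * b * c))"
      using cong_cmult_leftI[of i p "b * c" a] by (simp add: i_def cong_def mult_ac)
    show "[b * j = b * q] (mod (a * b * c))"
      using cong_cmult_leftI[of j q "c * a" b] by (simp add: j_def cong_def mult_ac)
    show "[c * k = c * r] (mod (a * b * c))"
      using cong_cmult_leftI[of k r "a * b" c] by (simp add: k_def cong_def mult_ac)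
  qed
  \<comment> \<open>Checked modulo a, b and c separately. Modulo c, for instance, the term cr
    vanishes and q may be replaced by z, which leaves the congruence defining p.\<close>
  also have "[a * p + b * q + c * r = n] (mod (a * b * c))"
  proof (intro coprime_cong_mult)
    have "[a * p + (b * q + c * x) + c * (r - x) = a * 0 * p + n + c * 0] (mod a)"
      using diff right by (intro cong_add cong_mult) (simp_all add: cong_def)
    then show "[a * p + b * q + c * r = n] (mod a)"
      by (simp add: algebra_simps)
    have "[a * (p - y) + b * q + (c * r + a * y) = a * 0 + b * 0 * q + n] (mod b)"
      using diff right by (intro cong_add cong_mult) (simp_all add: cong_def)
    then show "[a * p + b * q + c * r = n] (mod b)"
      by (simp add: algebra_simps)
    have "[(a * p + b * z) + b * (q - z) + c * r = n + b * 0 + c * 0 * r] (mod c)"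
      using diff right by (intro cong_add cong_mult) (simp_all add: cong_def)
    then show "[a * p + b * q + c * r = n] (mod c)"
      by (simp add: algebra_simps)
  qed (use cop in simp_all)
  finally obtain J where J: "n = a * i + b * j + c * k + a * b * c * J"
    by (auto simp: cong_iff_lin)
  have ijk: "0 \<le> i" "i \<le> b * c - 1" "0 \<le> j" "j \<le> c * a - 1" "0 \<le> k" "k \<le> a * b - 1"
    using pos by (simp_all add: i_def j_def k_def)
  have "J < 0"
  proof (rule ccontr)
    assume "\<not> J < 0"
    then have "i + b * c * J \<ge> 0" using ijk pos by simp
    moreover have "n = (i + b * c * J) * a + j * b + k * c"
      using J by (simp add: algebra_simps)
    ultimately show False
      using n ijk unfolding representable3_def by blast
  qed
  \<comment> \<open>Since ai + bj + ck \<le> 3abc - (a+b+c), J \<le> -3 would force n \<le>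
    -(a+b+c).\<close>
  moreover have "J > - 3"
  proof (rule ccontr)
    assume "\<not> J > - 3"
    then have "a * b * c * J \<le> a * b * c * (- 3)"
      using pos by (intro mult_left_mono) auto
    moreover have "a * i \<le> a * (b * c - 1)" "b * j \<le> b * (c * a - 1)" "c * k \<le> c * (a * b - 1)"
      using ijk pos by (auto intro!: mult_left_mono)
    ultimately show False
      using n J by (simp add: algebra_simps)
  qed
  ultimately have "J = - 1 \<or> J = - 2" by linarith
  \<comment> \<open>The 3/2 collects the constants 1/2 of the three sawtooth values.\<close>
  moreover have "real_of_int n / (a * b * c) - saw p (b * c) - saw q (c * a) - saw r (a * b) = J + 3 / 2"
    unfolding saw_def i_def[symmetric] j_def[symmetric] k_def[symmetric] J
    using pos by (simp add: field_simps)
  ultimately show ?thesis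
    unfolding p_def q_def r_def by (auto simp: power2_eq_square)
qed

text \<open>Sum the pointwise value 1/4 over all abc triples and expand. The leading terms abc/12 of
  the three second moments cancel the total abc/4; their remainders give (a^2+b^2+c^2)/6 after
  multiplication by abc, and the first moments -1/2 give n(a+b+c).\<close>

lemma nonrepresentable_identity:
  fixes a b c n :: int
  assumes pos: "a > 0" "b > 0" "c > 0"
    and cop: "coprime a b" "coprime b c" "coprime a c"
    and n: "n > - (a + b + c)" "\<not> representable3 a b c n"
  shows "(real_of_int n)\<^sup>2 + n * (real_of_int a + b + c)
    + ((real_of_int a)\<^sup>2 + (real_of_int b)\<^sup>2 + (real_of_int c)\<^sup>2) / 6
    + 2 * real_of_int a * b * c *
      (dedekind_sum (modular_inverse a b * n) (- modular_inverse a b * c) a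
       + dedekind_sum (modular_inverse b c * n) (- modular_inverse b c * a) b
       + dedekind_sum (modular_inverse c a * n) (- modular_inverse c a * b) c) = 0"
    (is "_ + _ + _ + _ * (?A + ?B + ?C) = 0")
proof -
  define N where "N = real_of_int n / (a * b * c)"
  define U where "U y z = saw (crt_coeff a b c n y z) (b * c)" for y z
  define V where "V z x = saw (crt_coeff b c a n z x) (c * a)" for z x
  define W where "W x y = saw (crt_coeff c a b n x y) (a * b)" for x y
  have cop': "coprime b a" "coprime c b" "coprime c a"
    using cop by (simp_all add: coprime_commute)
  note A = pos cop and B = pos(2,3,1) cop(2) cop'(3) cop'(1) and C = pos(3,1,2) cop'(3) cop(1) cop'(2)
  have crt1: "(\<Sum>y\<in>{0..<b}. \<Sum>z\<in>{0..<c}. saw (crt_coeff a b c n y z) (b * c)) = - 1 / 2"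
    and crt2: "(\<Sum>y\<in>{0..<b}. \<Sum>z\<in>{0..<c}. (saw (crt_coeff a b c n y z) (b * c))\<^sup>2)
      = b * c / 12 + 1 / (6 * real_of_int b * c)"
    if "a > 0" "b > 0" "c > 0" "coprime a b" "coprime b c" "coprime a c" for a b c
    using sum_crt_coeff[OF that, of "\<lambda>i. saw i (b * c)" n]
      sum_crt_coeff[OF that, of "\<lambda>i. (saw i (b * c))\<^sup>2" n] sum_saw[of "b * c"]
      sum_saw_squares[of "b * c"] that
    by (simp_all add: mult.assoc)
  \<comment> \<open>The shared residue z becomes the summation index of the Dedekind sum modulo c;
    the other two pairs are cyclic rotations.\<close>
  have UV: "(\<Sum>z\<in>{0..<c}. (\<Sum>y\<in>{0..<b}. U y z) * (\<Sum>x\<in>{0..<a}. V z x)) = ?C"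
    unfolding U_def V_def sum_saw_crt_coeff_left[OF A] sum_saw_crt_coeff_right[OF B] dedekind_sum_def ..
  have VW: "(\<Sum>x\<in>{0..<a}. (\<Sum>z\<in>{0..<c}. V z x) * (\<Sum>y\<in>{0..<b}. W x y)) = ?A"
    unfolding V_def W_def sum_saw_crt_coeff_left[OF B] sum_saw_crt_coeff_right[OF C] dedekind_sum_def ..
  have WU: "(\<Sum>y\<in>{0..<b}. (\<Sum>x\<in>{0..<a}. W x y) * (\<Sum>z\<in>{0..<c}. U y z)) = ?B"
    unfolding W_def U_def sum_saw_crt_coeff_left[OF C] sum_saw_crt_coeff_right[OF A] dedekind_sum_def ..
  have "(\<Sum>x\<in>{0..<a}. \<Sum>y\<in>{0..<b}. \<Sum>z\<in>{0..<c}. (N - U y z - V z x - W x y)\<^sup>2)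
      = (\<Sum>x\<in>{0..<a}. \<Sum>y\<in>{0..<b}. \<Sum>z\<in>{0..<c}. 1 / 4)"
    unfolding N_def U_def V_def W_def
    by (intro sum.cong refl nonrepresentable_square[OF pos cop n])
  also have "\<dots> = real_of_int a * b * c / 4"
    using pos by simp
  finally have "real_of_int a * b * c * N\<^sup>2 - 2 * N * (a * (- 1 / 2) + b * (- 1 / 2) + c * (- 1 / 2))
      + a * (b * c / 12 + 1 / (6 * real_of_int b * c)) + b * (c * a / 12 + 1 / (6 * real_of_int c * a))
      + c * (a * b / 12 + 1 / (6 * real_of_int a * b)) + 2 * (?C + ?A + ?B) = real_of_int a * b * c / 4"
    unfolding sum_square_three UV VW WU
    unfolding U_def V_def W_def crt1[OF A] crt1[OF B] crt1[OF C] crt2[OF A] crt2[OF B] crt2[OF C]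
    using pos by simp
  then have "2 * (?A + ?B + ?C) = real_of_int a * b * c / 4 - (real_of_int a * b * c * N\<^sup>2
      - 2 * N * (a * (- 1 / 2) + b * (- 1 / 2) + c * (- 1 / 2))
      + a * (b * c / 12 + 1 / (6 * real_of_int b * c)) + b * (c * a / 12 + 1 / (6 * real_of_int c * a))
      + c * (a * b / 12 + 1 / (6 * real_of_int a * b)))"
    by (simp add: algebra_simps)
  also have "\<dots> = - ((real_of_int n)\<^sup>2 + n * (real_of_int a + b + c)
      + ((real_of_int a)\<^sup>2 + (real_of_int b)\<^sup>2 + (real_of_int c)\<^sup>2) / 6) / (real_of_int a * b * c)"
    using pos unfolding N_def by (simp add: field_simps power2_eq_square)
  finally have "2 * (?A + ?B + ?C) * (real_of_int a * b * c) = - ((real_of_int n)\<^sup>2 + n * (real_of_int a + b + c)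
      + ((real_of_int a)\<^sup>2 + (real_of_int b)\<^sup>2 + (real_of_int c)\<^sup>2) / 6)"
    using pos by (simp only:) simp
  then show ?thesis
    by (simp add: algebra_simps)
qed

section \<open>Deduction of the bound for the Frobenius number\<close>

theorem mainTheorem2:
  fixes a b c :: int and \<alpha> \<beta> \<gamma> :: real
  assumes "a \<ge> 2" and "b \<ge> 2" and "c \<ge> 2"
    and "coprime a b" and "coprime b c" and "coprime a c"
    and "\<alpha> = L b c a" and "\<beta> = L c a b" and "\<gamma> = L a b c"
  shows "real_of_int (frobenius3 a b c) \<le>
    sqrt (1 / 4 * (real_of_int a + real_of_int b + real_of_int c)\<^sup>2
          - 1 / 6 * ((real_of_int a)\<^sup>2 + (real_of_int b)\<^sup>2 + (real_of_int c)\<^sup>2)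
          - 2 * real_of_int a * real_of_int b * real_of_int c * (\<alpha> + \<beta> + \<gamma>))
    - 1 / 2 * (real_of_int a + real_of_int b + real_of_int c)"
    (is "_ \<le> ?R")
proof -
  have cop': "coprime b a" "coprime c b" "coprime c a"
    using assms by (simp_all add: coprime_commute)
  have bound: "real_of_int n \<le> ?R" if "\<not> representable3 a b c n" "n \<ge> 0" for n
  proof -
    define s where "s = real_of_int a + b + c"
    define d where "d = dedekind_sum (modular_inverse a b * n) (- modular_inverse a b * c) a
       + dedekind_sum (modular_inverse b c * n) (- modular_inverse b c * a) b
       + dedekind_sum (modular_inverse c a * n) (- modular_inverse c a * b) c"
    have "\<alpha> + \<beta> + \<gamma> \<le> d"
      unfolding d_def assms(7-9)
      by (intro add_mono L_le_dedekind_sum) (use assms cop' in auto)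
    then have "2 * real_of_int a * b * c * (\<alpha> + \<beta> + \<gamma>) \<le> 2 * real_of_int a * b * c * d"
      using assms by (intro mult_left_mono) auto
    moreover have "(real_of_int n)\<^sup>2 + n * s
        + ((real_of_int a)\<^sup>2 + (real_of_int b)\<^sup>2 + (real_of_int c)\<^sup>2) / 6 + 2 * real_of_int a * b * c * d = 0"
      unfolding s_def d_def using assms that by (intro nonrepresentable_identity) auto
    \<comment> \<open>Completing the square turns the quadratic equation into the stated
      radicand.\<close>
    moreover have "(real_of_int n + s / 2)\<^sup>2 = (real_of_int n)\<^sup>2 + n * s + s\<^sup>2 / 4"
      by (simp add: power2_eq_square algebra_simps)
    ultimately have "(real_of_int n + s / 2)\<^sup>2 \<le> 1 / 4 * s\<^sup>2
        - 1 / 6 * ((real_of_int a)\<^sup>2 + (real_of_int b)\<^sup>2 + (real_of_int c)\<^sup>2)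
        - 2 * real_of_int a * b * c * (\<alpha> + \<beta> + \<gamma>)"
      by linarith
    from real_le_rsqrt[OF this] show ?thesis
      by (simp add: s_def)
  qed
  \<comment> \<open>\<open>GREATEST\<close> is meaningful only if a maximum exists. The bound just
    proved makes \<open>S\<close> finite, and 1 lies in \<open>S\<close> because a, b, c \<ge> 2;
    thus Max S \<ge> 1 also dominates every nonrepresentable n below 1.\<close>
  define S where "S = {n. n \<ge> 1 \<and> \<not> representable3 a b c n}"
  have "\<not> representable3 a b c 1"
  proof
    assume "representable3 a b c 1"
    then obtain m1 m2 m3 where m: "m1 \<ge> 0" "m2 \<ge> 0" "m3 \<ge> 0" "1 = m1 * a + m2 * b + m3 * c"
      unfolding representable3_def by blast
    then have "m1 * 2 + m2 * 2 + m3 * 2 \<le> 1"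
      using assms by (simp only: m(4)) (intro add_mono mult_left_mono)
    then have "m1 = 0" "m2 = 0" "m3 = 0"
      using m(1-3) by auto
    with m(4) show False by simp
  qed
  then have one: "1 \<in> S" by (simp add: S_def)
  have "S \<subseteq> {1..\<lfloor>?R\<rfloor>}"
    using bound by (auto simp: S_def le_floor_iff)
  then have fin: "finite S" by (rule finite_subset) simp
  have "frobenius3 a b c = Max S"
    unfolding frobenius3_def
  proof (rule Greatest_equality)
    show "\<not> representable3 a b c (Max S)"
      using Max_in[OF fin] one by (auto simp: S_def)
    fix n assume "\<not> representable3 a b c n"
    then show "n \<le> Max S"
      using Max_ge[OF fin, of n] Max_ge[OF fin one] by (cases "n \<ge> 1") (auto simp: S_def)
  qed
  moreover have "Max S \<in> S"
    using Max_in[OF fin] one by auto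
  ultimately show ?thesis
    using bound[of "Max S"] by (simp add: S_def)
qed

end
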